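(* Let $s\in\{s^+,s^-\}$ be a value of the sensitive feature, let $\pi(d\mid\mathbf{x},s)$ be a Markov policy with decisions $d\in\{d^0,d^1\}$, let $\pi_0$ be the hypothetical baseline policy with $\pi_0(d^0\mid\mathbf{x},s)=1$, and let $\pi^{PS}$ be the hypothetical virtual policy under which states evolve as under $\pi$ while the qualification gain is obtained as under $\pi_0$. Let $V_{do(\pi,s)}$, $V_{do(\pi_0,s)}$, $V_{do(\pi^{PS},s)}$ be their state value functions for the qualification gain, given by the Bellman equations stated in the context. Then $$V_{do(\pi,s)}(\mathbf{x})-V_{do(\pi^{PS},s)}(\mathbf{x})=\sum_{\mathbf{x}'}\eta^{\pi,s}(\mathbf{x}\to\mathbf{x}')\,\pi(d^1\mid\mathbf{x}',s)\,\Delta(\mathbf{x}',s)$$ and $$V_{do(\pi^{PS},s)}(\mathbf{x})-V_{do(\pi_0,s)}(\mathbf{x})=\sum_{\mathbf{x}'}\left(\eta^{\pi,s}(\mathbf{x}\to\mathbf{x}')-\eta^{\pi_0,s}(\mathbf{x}\to\mathbf{x}')\right)\sum_{\mathbf{x}''}P(\mathbf{x}''\mid\mathbf{x}',d^0,s)\,g^s(\mathbf{x}',\mathbf{x}''),$$ where $\eta^{\pi,s}(\mathbf{x}\to\mathbf{x}')$ is the probability of transitioning from state $\mathbf{x}$ to state $\mathbf{x}'$ with policy $\pi$ after any number of steps, that is, $\eta^{\pi,s}(\mathbf{x}\to\mathbf{x}')=\sum_{k=0}^{\infty}\rho^{\pi,s}(\mathbf{x}\to\mathbf{x}',k)$ with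 $\rho^{\pi,s}$ as in the context (and likewise for $\pi_0$).
   Context: Decision process. A discrete-time Markov decision process: at each time step $t$ an individual with binary sensitive feature $s\in\{s^+,s^-\}$ and qualification state $\mathbf{x}_t$ receives a decision $d_t\in\{d^0,d^1\}$ ($d^0$: negative decision or non-treatment, $d^1$: positive decision or treatment) drawn from the policy $\pi(\cdot\mid\mathbf{x}_t,s)$, and then moves to state $\mathbf{x}_{t+1}$ with transition probability $P(\mathbf{x}_{t+1}\mid\mathbf{x}_t,d_t,s)$. Sums over $\mathbf{x}',\mathbf{x}''$ run over qualification states. Qualification gain. $g^s(\mathbf{x},\mathbf{x}')$ quantifies the increase or decrease in qualification when an individual of group $s$ moves from $\mathbf{x}$ to $\mathbf{x}'$. It may have any form satisfying additivity over intermediate states: $g^s(\mathbf{x},\mathbf{x}')=g^s(\mathbf{x},\mathbf{x}_2)+\cdots+g^s(\mathbf{x}_{n-1},\mathbf{x}')$ for all intermediate states $\mathbf{x}_2,\dots,\mathbf{x}_{n-1}$. Value function of $\pi$. The notation $do(\pi,s)$ denotes deploying policy $\pi$ (a soft intervention) and setting the sensitive feature to $s$ (a hard intervention). The expected qualification gain is $V_{do(\pi,s)}(\mathbf{x})=\mathbb{E}_{\pi}\left[\sum_{t=1}^{T}g^s(\mathbf{x}_t,\mathbf{x}_{t+1})\mid\mathbf{x}_1=\mathbf{x}\right]$, and it is expressed by the Bellman equation $$V_{do(\pi,s)}(\mathbf{x})=\sum_{d}\pi(d\mid\mathbf{x},s)\sum_{\mathbf{x}'}P(\mathbf{x}'\mid\mathbf{x},d,s)\left(g^s(\mathbf{x},\mathbf{x}')+V_{do(\pi,s)}(\mathbf{x}')\right).$$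 Value function of the baseline policy $\pi_0$ (which always decides $d^0$): $$V_{do(\pi_0,s)}(\mathbf{x})=\sum_{\mathbf{x}'}P(\mathbf{x}'\mid\mathbf{x},d^0,s)\left(g^s(\mathbf{x},\mathbf{x}')+V_{do(\pi_0,s)}(\mathbf{x}')\right).$$ Value function of the virtual policy $\pi^{PS}$ (gain obtained as if following $\pi_0$, state transitions as if under $\pi$): $$V_{do(\pi^{PS},s)}(\mathbf{x})=\sum_{\mathbf{x}'}P(\mathbf{x}'\mid\mathbf{x},d^0,s)\,g^s(\mathbf{x},\mathbf{x}')+\sum_{d}\pi(d\mid\mathbf{x},s)\sum_{\mathbf{x}'}P(\mathbf{x}'\mid\mathbf{x},d,s)\,V_{do(\pi^{PS},s)}(\mathbf{x}').$$ Benefit. $\Delta(\mathbf{x},s)=\sum_{\mathbf{x}'}\left(P(\mathbf{x}'\mid\mathbf{x},d^1,s)-P(\mathbf{x}'\mid\mathbf{x},d^0,s)\right)g^s(\mathbf{x},\mathbf{x}')$, the expected increase in qualification gain from receiving treatment compared with not receiving it. Step probabilities. $\rho^{\pi,s}(\mathbf{x}\to\mathbf{x}',k)$ is the probability of going from $\mathbf{x}$ to $\mathbf{x}'$ in exactly $k$ steps under policy $\pi$ in group $s$; e.g. $\rho^{\pi,s}(\mathbf{x}\to\mathbf{x}',1)=\sum_d\pi(d\mid\mathbf{x},s)P(\mathbf{x}'\mid\mathbf{x},d,s)$, and $\rho^{\pi,s}(\mathbf{x}\to\mathbf{x}',0)$ is $1$ if $\mathbf{x}'=\mathbf{x}$ and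 $0$ otherwise.
   Formalization: Added: one-step expected gains exist; the expected remaining value after n steps tends to 0 for each value function (the Bellman equations alone fix them only up to a constant); the η-weighted sums of benefit and of baseline gain (under π and π0) converge absolutely, as η may be infinite. *)

theory Defs
  imports "HOL-Probability.Probability"
begin

datatype sensitive = S_plus | S_minus

datatype decision = D0 | D1

(* 'x is the discrete (not necessarily finite) type of qualification states.
   P(x' | x, d, s) is "pmf (P x d s) x'" and pi(d | x, s) is "pmf (\<pi> x s) d". *)

type_synonym 'x transition = "'x \<Rightarrow> decision \<Rightarrow> sensitive \<Rightarrow> 'x pmf"
type_synonym 'x policy = "'x \<Rightarrow> sensitive \<Rightarrow> decision pmf"
type_synonym 'x gain = "sensitive \<Rightarrow> 'x \<Rightarrow> 'x \<Rightarrow> real"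

definition baseline_policy :: "'x policy" where
  "baseline_policy x s = return_pmf D0"

fun path_gain :: "('x \<Rightarrow> 'x \<Rightarrow> real) \<Rightarrow> 'x \<Rightarrow> 'x list \<Rightarrow> 'x \<Rightarrow> real" where
  "path_gain h x [] x' = h x x'"
| "path_gain h x (y # ys) x' = h x y + path_gain h y ys x'"

definition additive_gain :: "('x \<Rightarrow> 'x \<Rightarrow> real) \<Rightarrow> bool" where
  "additive_gain h \<longleftrightarrow> (\<forall>x ys x'. h x x' = path_gain h x ys x')"

(* Distribution of the state reached from x after exactly k steps. *)
primrec state_after :: "'x transition \<Rightarrow> 'x policy \<Rightarrow> sensitive \<Rightarrow> 'x \<Rightarrow> nat \<Rightarrow> 'x pmf" where
  "state_after P \<pi> s x 0 = return_pmf x"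
| "state_after P \<pi> s x (Suc k) =
     bind_pmf (state_after P \<pi> s x k) (\<lambda>y. bind_pmf (\<pi> y s) (\<lambda>d. P y d s))"

definition \<rho> :: "'x transition \<Rightarrow> 'x policy \<Rightarrow> sensitive \<Rightarrow> 'x \<Rightarrow> 'x \<Rightarrow> nat \<Rightarrow> real" where
  "\<rho> P \<pi> s x x' k = pmf (state_after P \<pi> s x k) x'"

(* The value is meaningful only when the series converges; it diverges when x' is recurrent and
   reachable from x. Hence "occupation_summable" below, which forces the factor that multiplies
   \<eta> to vanish wherever \<eta> diverges. *)
definition \<eta> :: "'x transition \<Rightarrow> 'x policy \<Rightarrow> sensitive \<Rightarrow> 'x \<Rightarrow> 'x \<Rightarrow> real" where
  "\<eta> P \<pi> s x x' = (\<Sum>k. \<rho> P \<pi> s x x' k)"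

definition \<Delta> :: "'x transition \<Rightarrow> 'x gain \<Rightarrow> 'x \<Rightarrow> sensitive \<Rightarrow> real" where
  "\<Delta> P g x s = (\<Sum>\<^sub>\<infinity>x'. (pmf (P x D1 s) x' - pmf (P x D0 s) x') * g s x x')"

definition bellman :: "'x transition \<Rightarrow> 'x gain \<Rightarrow> 'x policy \<Rightarrow> sensitive \<Rightarrow> ('x \<Rightarrow> real) \<Rightarrow> bool" where
  "bellman P g \<pi> s V \<longleftrightarrow>
     (\<forall>x. V x = (\<Sum>d\<in>{D0, D1}. pmf (\<pi> x s) d *
                  (\<Sum>\<^sub>\<infinity>x'. pmf (P x d s) x' * (g s x x' + V x'))))"

definition bellman_baseline :: "'x transition \<Rightarrow> 'x gain \<Rightarrow> sensitive \<Rightarrow> ('x \<Rightarrow> real) \<Rightarrow> bool" where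
  "bellman_baseline P g s V \<longleftrightarrow>
     (\<forall>x. V x = (\<Sum>\<^sub>\<infinity>x'. pmf (P x D0 s) x' * (g s x x' + V x')))"

definition bellman_virtual :: "'x transition \<Rightarrow> 'x gain \<Rightarrow> 'x policy \<Rightarrow> sensitive \<Rightarrow> ('x \<Rightarrow> real) \<Rightarrow> bool" where
  "bellman_virtual P g \<pi> s V \<longleftrightarrow>
     (\<forall>x. V x = (\<Sum>\<^sub>\<infinity>x'. pmf (P x D0 s) x' * g s x x')
              + (\<Sum>d\<in>{D0, D1}. pmf (\<pi> x s) d * (\<Sum>\<^sub>\<infinity>x'. pmf (P x d s) x' * V x')))"

definition integrable_gain :: "'x transition \<Rightarrow> 'x gain \<Rightarrow> sensitive \<Rightarrow> bool" where
  "integrable_gain P g s \<longleftrightarrow> (\<forall>x d. (\<lambda>x'. pmf (P x d s) x' * g s x x') summable_on UNIV)"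

(* The undiscounted Bellman equations are invariant under adding a constant to V, so they do not
   determine a value function by themselves. Vanishing of the expected value remaining after
   n steps (states evolving under \<pi>) is what makes a solution the total expected gain over the
   infinite horizon. *)
definition vanishing_remainder :: "'x transition \<Rightarrow> 'x policy \<Rightarrow> sensitive \<Rightarrow> ('x \<Rightarrow> real) \<Rightarrow> bool" where
  "vanishing_remainder P \<pi> s V \<longleftrightarrow>
     (\<forall>x. (\<forall>n. (\<lambda>x'. \<rho> P \<pi> s x x' n * V x') summable_on UNIV) \<and>
          (\<lambda>n. \<Sum>\<^sub>\<infinity>x'. \<rho> P \<pi> s x x' n * V x') \<longlonglongrightarrow> 0)"

(* Absolute convergence of the double series of \<rho>(x \<rightarrow> x', k) * f x' over k and x', for every x
   (for real-valued families "summable_on" is absolute). On a finite state type this says exactly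
   that \<eta>(x \<rightarrow> x') converges wherever f x' is nonzero. *)
definition occupation_summable :: "'x transition \<Rightarrow> 'x policy \<Rightarrow> sensitive \<Rightarrow> ('x \<Rightarrow> real) \<Rightarrow> bool" where
  "occupation_summable P \<pi> s f \<longleftrightarrow>
     (\<forall>x. (\<lambda>(k, x'). \<rho> P \<pi> s x x' k * f x') summable_on UNIV)"

end

theory Submission
  imports Defs
begin

text \<open>
  Write K for the one-step kernel of \<open>\<pi>\<close>. Each Bellman equation has the form
  \<open>W = f + K W\<close>. Iterating, \<open>W = (\<Sum>k<n. K^k f) + K^n W\<close>; the remainder vanishes, so
  \<open>W = (\<Sum>k. K^k f) = \<eta> f\<close>, where absolute convergence permits exchanging the sums over steps and
  states. Let r be the expected one-step gain under D0. The equation for V has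
  \<open>f = r + \<pi>(D1) \<Delta>\<close> and the one for VPS has \<open>f = r\<close>, so \<open>V - VPS\<close> solves the equation with
  \<open>f = \<pi>(D1) \<Delta>\<close>. The equation for V0 has \<open>f = r\<close> and the kernel of the baseline policy.
\<close>

section \<open>Unconditional sums and mixtures of distributions\<close>

lemma has_sum_diff:
  fixes f g :: "'a \<Rightarrow> 'b::topological_ab_group_add"
  assumes "(f has_sum a) A" "(g has_sum b) A"
  shows "((\<lambda>x. f x - g x) has_sum (a - b)) A"
  using has_sum_add[OF assms(1), of "\<lambda>x. - g x" "- b"] assms(2) by (simp add: has_sum_uminus)

lemma
  fixes f g :: "'a \<Rightarrow> 'b::{topological_ab_group_add, t2_space}"
  assumes "f summable_on A" "g summable_on A"
  shows summable_on_diff: "(\<lambda>x. f x - g x) summable_on A"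
    and infsum_diff: "(\<Sum>\<^sub>\<infinity>x\<in>A. f x - g x) = infsum f A - infsum g A"
  using has_sum_diff[OF assms[THEN has_sum_infsum]] by (auto simp: has_sum_iff)

text \<open>The expectation behind \<open>pmf_bind\<close> unfolds to an \<open>infsetsum\<close>.
  Domination by \<open>pmf p\<close> makes the family absolutely summable, which carries the
  identity over to \<open>has_sum\<close>.\<close>

lemma has_sum_pmf_bind:
  "((\<lambda>y. pmf p y * pmf (f y) z) has_sum pmf (bind_pmf p f) z) UNIV"
proof -
  have "Infinite_Set_Sum.abs_summable_on (\<lambda>y. pmf p y * pmf (f y) z) UNIV"
    by (rule abs_summable_on_comparison_test[OF pmf_abs_summable[of p]])
       (auto simp: abs_mult intro!: mult_left_le pmf_le_1)
  moreover have "pmf (bind_pmf p f) z = infsetsum (\<lambda>y. pmf p y * pmf (f y) z) UNIV"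
    by (simp add: pmf_bind pmf_expectation_eq_infsetsum)
  ultimately show ?thesis
    using abs_summable_summable[OF abs_summable_equivalent[THEN iffD2]]
    by (simp add: has_sum_iff infsetsum_infsum)
qed

section \<open>Iterating the one-step kernel and summing over all steps\<close>

lemma \<rho>_nonneg [simp]: "0 \<le> \<rho> P \<pi> s x y k"
  by (simp add: \<rho>_def)

lemma has_sum_\<rho>_Suc:
  "((\<lambda>y. \<rho> P \<pi> s x y k * \<rho> P \<pi> s y z 1) has_sum \<rho> P \<pi> s x z (Suc k)) UNIV"
  using has_sum_pmf_bind[of "state_after P \<pi> s x k" "\<lambda>y. bind_pmf (\<pi> y s) (\<lambda>d. P y d s)" z]
  by (simp add: \<rho>_def bind_return_pmf)

lemma UNIV_decision: "UNIV = {D0, D1}"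
  using decision.exhaust by blast

lemma \<rho>_1: "\<rho> P \<pi> s x y 1 = (\<Sum>d\<in>{D0, D1}. pmf (\<pi> x s) d * pmf (P x d s) y)"
proof -
  have "\<rho> P \<pi> s x y 1 = (LINT d|measure_pmf (\<pi> x s). pmf (P x d s) y)"
    by (simp add: \<rho>_def bind_return_pmf pmf_bind)
  also have "\<dots> = (\<Sum>d\<in>{D0, D1}. pmf (\<pi> x s) d *\<^sub>R pmf (P x d s) y)"
    by (rule integral_measure_pmf) (use decision.exhaust in \<open>simp, blast\<close>)
  finally show ?thesis by simp
qed

lemma sum_pmf_decision: "pmf p D0 + pmf p D1 = 1"
  using sum_pmf_eq_1[of "{D0, D1}" p] subset_UNIV[of "set_pmf p"] unfolding UNIV_decision by simp

text \<open>This is K^n (K W) = K^(n+1) W. As \<rho> is nonnegative, Chapman-Kolmogorov sums the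
  norms over the intermediate state y exactly to those of the assumed family; hence the double
  family is absolutely summable and Fubini applies.\<close>

lemma infsum_\<rho>_Suc:
  assumes W: "(\<lambda>z. \<rho> P \<pi> s x z (Suc n) * W z) summable_on UNIV"
  shows "(\<lambda>y. \<rho> P \<pi> s x y n * (\<Sum>\<^sub>\<infinity>z. \<rho> P \<pi> s y z 1 * W z)) summable_on UNIV" (is ?A)
    and "(\<Sum>\<^sub>\<infinity>y. \<rho> P \<pi> s x y n * (\<Sum>\<^sub>\<infinity>z. \<rho> P \<pi> s y z 1 * W z)) =
           (\<Sum>\<^sub>\<infinity>z. \<rho> P \<pi> s x z (Suc n) * W z)" (is ?B)
proof -
  let ?h = "\<lambda>z y. \<rho> P \<pi> s x y n * (\<rho> P \<pi> s y z 1 * W z)"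
  \<comment> \<open>The factor w is kept arbitrary: \<open>\<bar>W z\<bar>\<close> gives absolute
    summability, \<open>W z\<close> gives the value.\<close>
  have hs: "((\<lambda>y. \<rho> P \<pi> s x y n * (\<rho> P \<pi> s y z 1 * w)) has_sum \<rho> P \<pi> s x z (Suc n) * w) UNIV" for z w
    using has_sum_cmult_left[OF has_sum_\<rho>_Suc] by (simp add: mult.assoc)
  have "(\<lambda>(z, y). norm (?h z y)) summable_on UNIV \<times> UNIV"
  proof (rule summable_on_SigmaI)
    show "((\<lambda>y. case (z, y) of (z, y) \<Rightarrow> norm (?h z y)) has_sum norm (\<rho> P \<pi> s x z (Suc n) * W z)) UNIV" for z
      using hs[of z "\<bar>W z\<bar>"] by (simp add: abs_mult)
    show "(\<lambda>z. norm (\<rho> P \<pi> s x z (Suc n) * W z)) summable_on UNIV"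
      using W by (rule summable_on_iff_abs_summable_on_real[THEN iffD1])
  qed auto
  then have sm: "(\<lambda>(z, y). ?h z y) summable_on UNIV \<times> UNIV"
    by (subst summable_on_iff_abs_summable_on_real) (simp add: case_prod_unfold)
  then have "(\<lambda>(y, z). ?h z y) summable_on UNIV \<times> UNIV"
    by (subst (asm) summable_on_swap) (simp add: case_prod_unfold)
  from summable_on_Sigma_banach[OF this]
  \<comment> \<open>Pulling out \<open>\<rho> P \<pi> s x y n\<close> needs no convergence: if it is
    0, the inner sum over z may diverge, yet both sides are 0.\<close>
  show ?A by (simp add: infsum_cmult_right')
  have "(\<Sum>\<^sub>\<infinity>y. \<rho> P \<pi> s x y n * (\<Sum>\<^sub>\<infinity>z. \<rho> P \<pi> s y z 1 * W z)) = (\<Sum>\<^sub>\<infinity>y. \<Sum>\<^sub>\<infinity>z. ?h z y)"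
    by (simp add: infsum_cmult_right')
  also have "\<dots> = (\<Sum>\<^sub>\<infinity>z. \<Sum>\<^sub>\<infinity>y. ?h z y)"
    by (rule infsum_swap_banach[OF sm, symmetric])
  also have "\<dots> = (\<Sum>\<^sub>\<infinity>z. \<rho> P \<pi> s x z (Suc n) * W z)"
    by (intro infsum_cong infsumI hs)
  finally show ?B .
qed

text \<open>Fubini for the double family over steps k and states y: summing over k first gives
  \<eta> f, summing over y first gives the terms K^k f of the iteration.\<close>

lemma has_sum_\<eta>:
  assumes "occupation_summable P \<pi> s f"
  shows "((\<lambda>y. \<eta> P \<pi> s x y * f y) has_sum (\<Sum>\<^sub>\<infinity>k. \<Sum>\<^sub>\<infinity>y. \<rho> P \<pi> s x y k * f y)) UNIV"
    and "(\<lambda>k. \<Sum>\<^sub>\<infinity>y. \<rho> P \<pi> s x y k * f y) summable_on UNIV"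
    and "(\<lambda>y. \<rho> P \<pi> s x y k * f y) summable_on UNIV"
proof -
  let ?h = "\<lambda>k y. \<rho> P \<pi> s x y k * f y"
  have sm: "(\<lambda>(k, y). ?h k y) summable_on UNIV \<times> UNIV"
    using assms by (simp add: occupation_summable_def)
  then have sm': "(\<lambda>(y, k). ?h k y) summable_on UNIV \<times> UNIV"
    by (subst (asm) summable_on_swap) (simp add: case_prod_unfold)
  show "(\<lambda>k. \<Sum>\<^sub>\<infinity>y. ?h k y) summable_on UNIV"
    using summable_on_Sigma_banach[OF sm] by simp
  show "?h k summable_on UNIV"
    using summable_on_SigmaD1[OF sm, of k] by simp
  have \<eta>: "(\<Sum>\<^sub>\<infinity>k. ?h k y) = \<eta> P \<pi> s x y * f y" for y
  proof (cases "f y = 0") \<comment> \<open>if \<open>f y = 0\<close>, the series defining \<open>\<eta>\<close> may diverge\<close>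
    case False
    have "(\<lambda>k. ?h k y) summable_on UNIV"
      using summable_on_SigmaD1[OF sm', of y] by simp
    then have "(\<lambda>k. \<rho> P \<pi> s x y k) summable_on UNIV"
      using False summable_on_cmult_left' by blast
    \<comment> \<open>\<eta> is an ordered series; unconditional summability identifies it with
      \<open>infsum\<close>.\<close>
    then have "(\<Sum>\<^sub>\<infinity>k. \<rho> P \<pi> s x y k) = \<eta> P \<pi> s x y"
      unfolding \<eta>_def by (metis has_sum_imp_sums has_sum_infsum sums_unique)
    then show ?thesis by (simp add: infsum_cmult_left')
  qed simp
  have "(\<lambda>y. \<eta> P \<pi> s x y * f y) summable_on UNIV"
    using summable_on_Sigma_banach[OF sm'] by (simp add: \<eta>)
  moreover have "(\<Sum>\<^sub>\<infinity>y. \<eta> P \<pi> s x y * f y) = (\<Sum>\<^sub>\<infinity>k. \<Sum>\<^sub>\<infinity>y. ?h k y)"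
    using infsum_swap_banach[OF sm] by (simp add: \<eta>)
  ultimately show "((\<lambda>y. \<eta> P \<pi> s x y * f y) has_sum (\<Sum>\<^sub>\<infinity>k. \<Sum>\<^sub>\<infinity>y. ?h k y)) UNIV"
    unfolding has_sum_iff ..
qed

text \<open>Policy, source term f and solution W stay generic because three instances are used:
  \<open>V - VPS\<close> and \<open>VPS\<close> under \<pi>, and \<open>V0\<close> under the
  baseline policy.\<close>

lemma has_sum_value:
  assumes fixpoint: "\<And>y. W y = f y + (\<Sum>\<^sub>\<infinity>z. \<rho> P \<pi> s y z 1 * W z)"
    and "vanishing_remainder P \<pi> s W" and f: "occupation_summable P \<pi> s f"
  shows "((\<lambda>y. \<eta> P \<pi> s x y * f y) has_sum W x) UNIV"
proof -
  let ?F = "\<lambda>k. \<Sum>\<^sub>\<infinity>y. \<rho> P \<pi> s x y k * f y" and ?R = "\<lambda>n. \<Sum>\<^sub>\<infinity>y. \<rho> P \<pi> s x y n * W y"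
  have W: "(\<lambda>y. \<rho> P \<pi> s x y n * W y) summable_on UNIV" and lim: "?R \<longlonglongrightarrow> 0" for n
    using assms(2) by (auto simp: vanishing_remainder_def)
  have step: "?R n = ?F n + ?R (Suc n)" for n
  proof -
    have "?R n = (\<Sum>\<^sub>\<infinity>y. \<rho> P \<pi> s x y n * f y + \<rho> P \<pi> s x y n * (\<Sum>\<^sub>\<infinity>z. \<rho> P \<pi> s y z 1 * W z))"
      by (subst fixpoint) (simp add: distrib_left)
    also have "\<dots> = ?F n + ?R (Suc n)"
      by (simp only: infsum_add[OF has_sum_\<eta>(3)[OF f] infsum_\<rho>_Suc(1)[OF W]]
          infsum_\<rho>_Suc(2)[OF W])
    finally show ?thesis .
  qed
  have "?R 0 = (\<Sum>\<^sub>\<infinity>y\<in>{x}. W y)"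
    by (rule infsum_cong_neutral) (auto simp: \<rho>_def)
  then have "?R 0 = W x" by simp
  have "(\<lambda>k. ?R k - ?R (Suc k)) sums (?R 0 - 0)"
    by (rule telescope_sums'[OF lim])
  moreover have "?R k - ?R (Suc k) = ?F k" for k
    using step[of k] by simp
  ultimately have "?F sums W x"
    using \<open>?R 0 = W x\<close> by simp
  \<comment> \<open>Telescoping evaluates the series in the order of the steps; absolute summability
    evaluates it as \<open>infsum\<close>. The two values must coincide.\<close>
  moreover have "?F sums infsum ?F UNIV"
    by (rule has_sum_imp_sums[OF has_sum_infsum[OF has_sum_\<eta>(2)[OF f]]])
  ultimately have "W x = infsum ?F UNIV"
    by (rule sums_unique2)
  then show ?thesis
    using has_sum_\<eta>(1)[OF f, of x] by simp
qed

section \<open>Bellman equations as fixed-point equations of the one-step kernel\<close>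

lemma vanishing_remainderD:
  assumes "vanishing_remainder P \<pi> s W"
  shows "(\<lambda>y. \<rho> P \<pi> s x y 1 * W y) summable_on UNIV"
  using assms by (auto simp: vanishing_remainder_def)

text \<open>Each decision's share is dominated by the mixture \<rho>. The weight
  \<open>pmf (\<pi> x s) d\<close> has to stay, since a decision of probability 0 leaves no trace in
  \<rho>.\<close>

lemma summable_on_decision:
  assumes "(\<lambda>y. \<rho> P \<pi> s x y 1 * W y) summable_on UNIV"
  shows "(\<lambda>y. pmf (\<pi> x s) d * (pmf (P x d s) y * W y)) summable_on UNIV"
proof -
  have "(\<lambda>y. norm (\<rho> P \<pi> s x y 1 * W y)) summable_on UNIV"
    using assms by (rule summable_on_iff_abs_summable_on_real[THEN iffD1])
  moreover have "norm (pmf (\<pi> x s) d * (pmf (P x d s) y * W y)) \<le> norm (\<rho> P \<pi> s x y 1 * W y)" for y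
  proof -
    have "pmf (\<pi> x s) d * pmf (P x d s) y \<le> \<rho> P \<pi> s x y 1"
      unfolding \<rho>_1 by (rule member_le_sum) (use decision.exhaust in auto)
    from mult_right_mono[OF this, of "\<bar>W y\<bar>"] show ?thesis
      by (simp add: abs_mult mult.assoc)
  qed
  ultimately show ?thesis
    by (rule abs_summable_summable[OF Infinite_Sum.abs_summable_on_comparison_test']) 
qed

lemma infsum_\<rho>_1:
  assumes "(\<lambda>y. \<rho> P \<pi> s x y 1 * W y) summable_on UNIV"
  shows "(\<Sum>\<^sub>\<infinity>y. \<rho> P \<pi> s x y 1 * W y) =
    (\<Sum>d\<in>{D0, D1}. pmf (\<pi> x s) d * (\<Sum>\<^sub>\<infinity>y. pmf (P x d s) y * W y))"
proof -
  have "(\<Sum>\<^sub>\<infinity>y. \<rho> P \<pi> s x y 1 * W y) =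
      (\<Sum>\<^sub>\<infinity>y. \<Sum>d\<in>{D0, D1}. pmf (\<pi> x s) d * (pmf (P x d s) y * W y))"
    by (simp only: \<rho>_1 sum_distrib_right mult.assoc)
  also have "\<dots> = (\<Sum>d\<in>{D0, D1}. \<Sum>\<^sub>\<infinity>y. pmf (\<pi> x s) d * (pmf (P x d s) y * W y))"
    using infsum_add[OF summable_on_decision[OF assms, of D0] summable_on_decision[OF assms, of D1]]
    by simp
  finally show ?thesis by (simp add: infsum_cmult_right')
qed

definition baseline_gain :: "'x transition \<Rightarrow> 'x gain \<Rightarrow> sensitive \<Rightarrow> 'x \<Rightarrow> real" where
  "baseline_gain P g s x = (\<Sum>\<^sub>\<infinity>x'. pmf (P x D0 s) x' * g s x x')"

text \<open>With the weight of \<open>D0\<close> written as 1 minus that of \<open>D1\<close>,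
  treatment contributes only its excess over non-treatment, which is \<Delta>.\<close>

lemma expected_gain_decomp:
  assumes "integrable_gain P g s"
  shows "(\<Sum>d\<in>{D0, D1}. pmf p d * (\<Sum>\<^sub>\<infinity>y. pmf (P x d s) y * g s x y)) =
    baseline_gain P g s x + pmf p D1 * \<Delta> P g x s"
proof -
  have sm: "(\<lambda>y. pmf (P x d s) y * g s x y) summable_on UNIV" for d
    using assms by (simp add: integrable_gain_def)
  have "\<Delta> P g x s = (\<Sum>\<^sub>\<infinity>y. pmf (P x D1 s) y * g s x y) - baseline_gain P g s x"
    unfolding \<Delta>_def baseline_gain_def left_diff_distrib by (rule infsum_diff[OF sm sm])
  moreover have "pmf p D0 = 1 - pmf p D1"
    using sum_pmf_decision[of p] by linarith
  ultimately show ?thesis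
    by (simp add: baseline_gain_def left_diff_distrib right_diff_distrib)
qed

text \<open>Separating gain from continuation value needs both sums to converge: the gain by
  integrability, the value by the one-step case of the vanishing remainder.\<close>

lemma bellman_fixpoint:
  assumes g: "integrable_gain P g s" and V: "bellman P g \<pi> s V" "vanishing_remainder P \<pi> s V"
  shows "V x = baseline_gain P g s x + pmf (\<pi> x s) D1 * \<Delta> P g x s
    + (\<Sum>\<^sub>\<infinity>y. \<rho> P \<pi> s x y 1 * V y)"
proof -
  have split: "pmf (\<pi> x s) d * (\<Sum>\<^sub>\<infinity>y. pmf (P x d s) y * (g s x y + V y)) =
      pmf (\<pi> x s) d * (\<Sum>\<^sub>\<infinity>y. pmf (P x d s) y * g s x y)
    + pmf (\<pi> x s) d * (\<Sum>\<^sub>\<infinity>y. pmf (P x d s) y * V y)" for d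
  proof (cases "pmf (\<pi> x s) d = 0") \<comment> \<open>if so, V need not be integrable under \<open>P x d s\<close>\<close>
    case False
    then have "(\<lambda>y. pmf (P x d s) y * V y) summable_on UNIV"
      using summable_on_decision[OF vanishing_remainderD[OF V(2)]] summable_on_cmult_right' by blast
    moreover have "(\<lambda>y. pmf (P x d s) y * g s x y) summable_on UNIV"
      using g by (simp add: integrable_gain_def)
    ultimately show ?thesis by (simp add: distrib_left infsum_add)
  qed simp
  have "V x = (\<Sum>d\<in>{D0, D1}. pmf (\<pi> x s) d * (\<Sum>\<^sub>\<infinity>y. pmf (P x d s) y * (g s x y + V y)))"
    by (rule V(1)[unfolded bellman_def, rule_format])
  also have "\<dots> = baseline_gain P g s x + pmf (\<pi> x s) D1 * \<Delta> P g x s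
      + (\<Sum>\<^sub>\<infinity>y. \<rho> P \<pi> s x y 1 * V y)"
    unfolding split sum.distrib expected_gain_decomp[OF g] infsum_\<rho>_1[OF vanishing_remainderD[OF V(2)]] ..
  finally show ?thesis .
qed

lemma bellman_virtual_fixpoint:
  assumes "bellman_virtual P g \<pi> s V" "vanishing_remainder P \<pi> s V"
  shows "V x = baseline_gain P g s x + (\<Sum>\<^sub>\<infinity>y. \<rho> P \<pi> s x y 1 * V y)"
  unfolding infsum_\<rho>_1[OF vanishing_remainderD[OF assms(2)]] baseline_gain_def
  by (rule assms(1)[unfolded bellman_virtual_def, rule_format])

lemma pmf_baseline_policy [simp]:
  "pmf (baseline_policy x s) D0 = 1" "pmf (baseline_policy x s) D1 = 0"
  by (simp_all add: baseline_policy_def)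

lemma bellman_baseline_policy_iff:
  "bellman P g baseline_policy s V \<longleftrightarrow> bellman_baseline P g s V"
  by (simp add: bellman_def bellman_baseline_def)

lemma vanishing_remainder_diff:
  assumes "vanishing_remainder P \<pi> s V" "vanishing_remainder P \<pi> s W"
  shows "vanishing_remainder P \<pi> s (\<lambda>x. V x - W x)"
proof -
  have V: "(\<lambda>y. \<rho> P \<pi> s x y n * V y) summable_on UNIV"
    and W: "(\<lambda>y. \<rho> P \<pi> s x y n * W y) summable_on UNIV" for x n
    using assms by (auto simp: vanishing_remainder_def)
  have "(\<lambda>n. (\<Sum>\<^sub>\<infinity>y. \<rho> P \<pi> s x y n * V y) - (\<Sum>\<^sub>\<infinity>y. \<rho> P \<pi> s x y n * W y)) \<longlonglongrightarrow> 0 - 0" for x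
    using assms by (intro tendsto_diff) (auto simp: vanishing_remainder_def)
  then show ?thesis
    by (simp add: vanishing_remainder_def right_diff_distrib infsum_diff[OF V W]
        summable_on_diff[OF V W])
qed

theorem proposition1:
  fixes P :: "'x transition" and \<pi> :: "'x policy" and g :: "'x gain" and s :: sensitive
    and V V0 VPS :: "'x \<Rightarrow> real" and x :: 'x
  assumes gain: "additive_gain (g s)"
    and integrable: "integrable_gain P g s"
    and V: "bellman P g \<pi> s V" "vanishing_remainder P \<pi> s V"
    and V0: "bellman_baseline P g s V0" "vanishing_remainder P baseline_policy s V0"
    and VPS: "bellman_virtual P g \<pi> s VPS" "vanishing_remainder P \<pi> s VPS"
    and benefit_summable: "occupation_summable P \<pi> s (\<lambda>x'. pmf (\<pi> x' s) D1 * \<Delta> P g x' s)"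
    and gain_summable: "occupation_summable P \<pi> s (\<lambda>x'. \<Sum>\<^sub>\<infinity>x''. pmf (P x' D0 s) x'' * g s x' x'')"
      "occupation_summable P baseline_policy s (\<lambda>x'. \<Sum>\<^sub>\<infinity>x''. pmf (P x' D0 s) x'' * g s x' x'')"
  shows "V x - VPS x = (\<Sum>\<^sub>\<infinity>x'. \<eta> P \<pi> s x x' * pmf (\<pi> x' s) D1 * \<Delta> P g x' s) \<and>
    VPS x - V0 x = (\<Sum>\<^sub>\<infinity>x'. (\<eta> P \<pi> s x x' - \<eta> P baseline_policy s x x') *
      (\<Sum>\<^sub>\<infinity>x''. pmf (P x' D0 s) x'' * g s x' x''))"
proof
  \<comment> \<open>Both equations share the kernel of \<pi>, so subtracting them cancels the
    baseline gain.\<close>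
  have "V y - VPS y = pmf (\<pi> y s) D1 * \<Delta> P g y s + (\<Sum>\<^sub>\<infinity>z. \<rho> P \<pi> s y z 1 * (V z - VPS z))" for y
    unfolding right_diff_distrib infsum_diff[OF vanishing_remainderD[OF V(2)] vanishing_remainderD[OF VPS(2)]]
    using bellman_fixpoint[OF integrable V, of y] bellman_virtual_fixpoint[OF VPS, of y] by simp
  from has_sum_value[OF this vanishing_remainder_diff[OF V(2) VPS(2)] benefit_summable, of x]
  show "V x - VPS x = (\<Sum>\<^sub>\<infinity>x'. \<eta> P \<pi> s x x' * pmf (\<pi> x' s) D1 * \<Delta> P g x' s)"
    by (simp add: infsumI mult.assoc)
next
  note gain_summable = gain_summable[folded baseline_gain_def]
  \<comment> \<open>The baseline policy gives \<open>D1\<close> weight 0, which removes the benefit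
    term.\<close>
  have "V0 y = baseline_gain P g s y + (\<Sum>\<^sub>\<infinity>z. \<rho> P baseline_policy s y z 1 * V0 z)" for y
    using bellman_fixpoint[OF integrable _ V0(2), of y] V0(1)
    by (simp add: bellman_baseline_policy_iff)
  note V0_sum = has_sum_value[OF this V0(2) gain_summable(2), of x]
  note VPS_sum = has_sum_value[OF bellman_virtual_fixpoint[OF VPS] VPS(2) gain_summable(1), of x]
  \<comment> \<open>Here the kernels differ but the source term is the same, so the two occupation
    sums are subtracted state by state.\<close>
  show "VPS x - V0 x = (\<Sum>\<^sub>\<infinity>x'. (\<eta> P \<pi> s x x' - \<eta> P baseline_policy s x x') *
      (\<Sum>\<^sub>\<infinity>x''. pmf (P x' D0 s) x'' * g s x' x''))"
    using has_sum_diff[OF VPS_sum V0_sum]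
    by (simp add: infsumI left_diff_distrib baseline_gain_def)
qed

end
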